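(* Let $q$ be an odd prime power with $q>124$ and let $n=\frac{q+1}{2}$. Then not every element of $\mathbb{F}_q$ is the sum of a $4$-potent and an $n$-potent of $\mathbb{F}_q$; that is, there exists $\gamma\in\mathbb{F}_q$ that cannot be written as $\alpha+\beta$ with $\alpha^n=\alpha$ and $\beta^4=\beta$.
   Context: $\mathbb{F}_q$ denotes the finite field with $q$ elements. For an integer $m>1$, an element $a\in\mathbb{F}_q$ is called an $m$-potent if $a^m=a$. *)

theory Defs
  imports Main
begin

definition potent :: "nat \<Rightarrow> 'a::monoid_mult \<Rightarrow> bool" where
  "potent m a \<longleftrightarrow> a ^ m = a"

end

theory Submission
  imports Defs "HOL-Computational_Algebra.Polynomial_Factorial"
begin

text \<open>
  Write \<open>q = 2 m + 1\<close>. The \<open>n\<close>-potents are \<open>0\<close> and the elements with \<open>x ^ m = 1\<close>, i.e. those where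
  the quadratic character \<open>\<chi>\<close> is not \<open>-1\<close>, and the \<open>4\<close>-potents are \<open>0\<close> and the cube roots of unity.
  So one needs an \<open>x\<close> with \<open>\<chi> (x - \<beta>) = -1\<close> for all \<open>4\<close>-potents \<open>\<beta>\<close>. If there is a primitive
  cube root of unity \<open>w\<close>, one expands the sum of
  \<open>(1 - \<chi> x) (1 - \<chi> (x - 1)) (1 - \<chi> (x - w)) (1 - \<chi> (x - w\<^sup>2))\<close>.
  The quadruple sum reduces to a triple sum by \<open>x \<mapsto> 1 / x\<close>, and each triple sum \<open>S\<close> satisfies
  the Hasse bound \<open>S \<le> 2 sqrt q\<close>.

  The Hasse bound follows Manin's argument. On \<open>f(t) y\<^sup>2 = f(x)\<close> over the rational functions in \<open>t\<close>,
  let \<open>d n\<close> be the degree of the numerator of the \<open>x\<close>-coordinate of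
  \<open>(t ^ q, f ^ m) + n (t, 1)\<close>. Then \<open>d (n - 1) + d (n + 1) = 2 d n + 2\<close>, \<open>d 0 = q\<close> and
  \<open>d 1 \<le> q + 1 - S\<close>, so \<open>0 \<le> d n \<le> n\<^sup>2 - S n + q\<close>; take \<open>n = S / 2\<close>. The group law is avoided:
  the \<open>x\<close>-coordinates of neighbours \<open>P\<close>, \<open>P + Q\<close> satisfy a symmetric biquadratic relation, and the next
  point is the other root of that quadratic equation.
\<close>

section \<open>Divisibility of polynomials over a field\<close>

text \<open>A nonzero element of least degree in the ideal generated by \<open>p\<close> and
  \<open>q\<close> divides every element of it, since remainders stay in the ideal; coprimality
  makes it a unit.\<close>

lemma field_poly_bezout:
  fixes p q :: "'a::field poly"
  assumes "coprime p q"
  obtains u v where "u * p + v * q = 1"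
proof -
  define I where "I = {u * p + v * q | u v. True}"
  have mem: "p \<in> I" "q \<in> I"
    unfolding I_def by (rule CollectI, rule exI[of _ 1], rule exI[of _ 0], simp)
      (rule CollectI, rule exI[of _ 0], rule exI[of _ 1], simp)
  have "p \<noteq> 0 \<or> q \<noteq> 0"
    using assms by auto
  then obtain r where r: "r \<in> I" "r \<noteq> 0"
    and min: "\<And>s. s \<in> I \<Longrightarrow> s \<noteq> 0 \<Longrightarrow> degree r \<le> degree s"
    using mem ex_has_least_nat[of "\<lambda>s. s \<in> I \<and> s \<noteq> 0" _ degree]
    by (metis (no_types, lifting))
  obtain u v where uv: "r = u * p + v * q"
    using r(1) unfolding I_def by blast
  have dvd: "r dvd s" if sI: "s \<in> I" for s
  proof -
    obtain u' v' where s: "s = u' * p + v' * q"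
      using sI unfolding I_def by blast
    have "s mod r = s - s div r * r"
      by (simp add: minus_div_mult_eq_mod)
    also have "\<dots> = (u' - s div r * u) * p + (v' - s div r * v) * q"
      by (simp only: uv[symmetric] s) (simp add: uv algebra_simps)
    finally have "s mod r \<in> I"
      unfolding I_def by blast
    then have "s mod r = 0"
      using min degree_mod_less'[of r s] r(2) by fastforce
    then show ?thesis by auto
  qed
  have "is_unit r"
    using assms dvd mem coprime_common_divisor by blast
  then obtain w where "1 = r * w" by (auto simp: dvd_def)
  then have "(w * u) * p + (w * v) * q = 1"
    by (simp add: uv algebra_simps)
  then show thesis by (rule that)
qed

lemma field_poly_coprime_dvd_mult:
  fixes p q r :: "'a::field poly"
  assumes "coprime p q" and "p dvd q * r"
  shows "p dvd r"
proof -
  obtain u v where "u * p + v * q = 1"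
    using field_poly_bezout[OF assms(1)] .
  then have "r = u * r * p + v * (q * r)"
    by algebra
  also have "p dvd \<dots>"
    by (intro dvd_add dvd_mult dvd_refl assms(2))
  finally show ?thesis .
qed

text \<open>A nonunit divisor of least degree cannot split into two nonunits. For
  \<open>p = 0\<close> the prime \<open>[:0, 1:]\<close> serves.\<close>

lemma field_poly_prime_divisor_exists:
  fixes p :: "'a::field poly"
  assumes "\<not> is_unit p"
  obtains r where "prime_elem r" and "r dvd p"
proof (cases "p = 0")
  case True
  have "prime_elem [:0, 1 :: 'a:]"
    by (rule prime_elem_linear_field_poly) simp
  then show thesis
    using that True by simp
next
  case False
  obtain r where r: "r dvd p" "\<not> is_unit r"
    and min: "\<And>s. s dvd p \<Longrightarrow> \<not> is_unit s \<Longrightarrow> degree r \<le> degree s"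
    using ex_has_least_nat[of "\<lambda>s. s dvd p \<and> \<not> is_unit s" p degree] assms by auto
  have r0: "r \<noteq> 0"
    using r(1) False by auto
  have "irreducible r"
  proof (rule irreducibleI)
    fix a b assume ab: "r = a * b"
    show "is_unit a \<or> is_unit b"
    proof (rule ccontr)
      assume *: "\<not> (is_unit a \<or> is_unit b)"
      have "a dvd p" "b dvd p"
        using r(1) ab dvd_mult_left dvd_mult_right by blast+
      then have "degree r \<le> degree a" "degree r \<le> degree b"
        using min * by auto
      moreover have "degree r = degree a + degree b"
        using r0 ab by (simp add: degree_mult_eq)
      ultimately have "degree a = 0" by simp
      then show False
        using * r0 ab is_unit_iff_degree[of a] by auto
    qed
  qed (use r r0 in auto)
  then show thesis
    using that r(1) field_poly_irreducible_imp_prime by blast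
qed

lemma prod_linear_factors_dvd:
  fixes p :: "'a::field poly"
  assumes "finite R" and "\<And>r. r \<in> R \<Longrightarrow> poly p r = 0"
  shows "(\<Prod>r\<in>R. [:-r, 1:]) dvd p"
  using assms
proof (induction R arbitrary: p rule: finite_induct)
  case (insert r R)
  obtain s where s: "p = [:-r, 1:] * s"
    using insert.prems[of r] by (auto simp: poly_eq_0_iff_dvd dvd_def)
  have "poly s x = 0" if "x \<in> R" for x
    using insert.prems[of x] insert.hyps(2) that s by auto
  then show ?case
    unfolding prod.insert[OF insert.hyps] s by (intro mult_dvd_mono dvd_refl insert.IH)
qed simp

section \<open>The chain of x-coordinates and the growth of their degrees\<close>

text \<open>
  For \<open>f(x) = x\<^sup>3 + a x\<^sup>2 + b x\<close>, the \<open>x\<close>-coordinates of \<open>P + Q\<close> and \<open>P - Q\<close> with \<open>x(P) = A / B\<close> and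
  \<open>x(Q) = t\<close> have product \<open>succ_U / succ_W\<close> and sum \<open>succ_V / succ_W\<close>. The point at infinity is
  represented by \<open>B = 0\<close>.
\<close>

definition succ_W :: "'a::comm_ring_1 \<Rightarrow> 'a \<Rightarrow> 'a \<Rightarrow> 'a" where
  "succ_W t A B = (A - t * B)\<^sup>2"

definition succ_U :: "'a::comm_ring_1 \<Rightarrow> 'a \<Rightarrow> 'a \<Rightarrow> 'a \<Rightarrow> 'a" where
  "succ_U b t A B = (A * t - b * B)\<^sup>2"

definition succ_V :: "'a::comm_ring_1 \<Rightarrow> 'a \<Rightarrow> 'a \<Rightarrow> 'a \<Rightarrow> 'a \<Rightarrow> 'a" where
  "succ_V a b t A B = 2 * ((A * t + b * B) * (A + t * B) + 2 * a * A * (t * B))"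

text \<open>The homogenised quadratic with roots x(P + Q) and x(P - Q), where x(P) = C / D,
  evaluated at A / B.\<close>

definition biquad :: "'a::comm_ring_1 \<Rightarrow> 'a \<Rightarrow> 'a \<Rightarrow> 'a \<Rightarrow> 'a \<Rightarrow> 'a \<Rightarrow> 'a \<Rightarrow> 'a" where
  "biquad a b t A B C D = succ_W t C D * A\<^sup>2 - succ_V a b t C D * A * B + succ_U b t C D * B\<^sup>2"

lemma biquad_sym: "biquad a b t A B C D = biquad a b t C D A B"
  unfolding biquad_def succ_W_def succ_U_def succ_V_def by (simp add: power2_eq_square algebra_simps)

text \<open>The fraction has a pole at infinity in t. \<open>B = 0\<close> is listed separately
  because the zero polynomial has degree 0, which would exclude the point at infinity with a
  constant numerator.\<close>

definition dominates :: "'a::zero poly \<Rightarrow> 'a poly \<Rightarrow> bool" where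
  "dominates A B \<longleftrightarrow> A \<noteq> 0 \<and> (B = 0 \<or> degree B < degree A)"

definition linked :: "'a::field \<Rightarrow> 'a \<Rightarrow> 'a poly \<Rightarrow> 'a poly \<Rightarrow> 'a poly \<Rightarrow> 'a poly \<Rightarrow> bool" where
  "linked a b A B C D \<longleftrightarrow> coprime A B \<and> coprime C D \<and> dominates A B \<and> dominates C D \<and>
     biquad [:a:] [:b:] [:0, 1:] A B C D = 0"

context
  fixes A B :: "'a::field poly"
  assumes dom: "dominates A B"
begin

lemma degree_B_le: "degree B \<le> degree A" and degree_tB_le: "degree ([:0, 1:] * B) \<le> degree A"
  using dom by (auto simp: dominates_def)

lemma degree_succ_U: "degree (succ_U [:b:] [:0, 1:] A B) = 2 * degree A + 2"
  and succ_U_nz: "succ_U [:b:] [:0, 1:] A B \<noteq> 0"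
proof -
  have A: "degree (A * [:0, 1:]) = degree A + 1"
    using dom by (subst degree_mult_eq) (auto simp: dominates_def)
  have B: "degree ([:b:] * B) \<le> degree A"
    using degree_B_le by simp
  define X where "X = A * [:0, 1:] - [:b:] * B"
  have "degree X = degree A + 1"
    unfolding X_def diff_conv_add_uminus
    by (subst degree_add_eq_left) (simp_all only: A degree_minus B less_Suc_eq_le Suc_eq_plus1[symmetric])
  moreover from this have "X \<noteq> 0" by auto
  ultimately show "degree (succ_U [:b:] [:0, 1:] A B) = 2 * degree A + 2" "succ_U [:b:] [:0, 1:] A B \<noteq> 0"
    unfolding succ_U_def X_def[symmetric] by (simp_all add: degree_power_eq)
qed

lemma degree_succ_V: "degree (succ_V [:a:] [:b:] [:0, 1:] A B) \<le> 2 * degree A + 1"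
proof -
  have 1: "degree (A * [:0, 1:] + [:b:] * B) \<le> degree A + 1"
    using degree_mult_le[of A "[:0, 1:]"] degree_B_le by (intro degree_add_le) auto
  have 2: "degree (A + [:0, 1:] * B) \<le> degree A"
    using degree_tB_le by (intro degree_add_le) auto
  have 3: "degree ((A * [:0, 1:] + [:b:] * B) * (A + [:0, 1:] * B)) \<le> 2 * degree A + 1"
    by (rule order.trans[OF degree_mult_le]) (use add_mono[OF 1 2] in linarith)
  have c: "2 * [:a:] = [:2 * a:]" by (simp add: numeral_poly)
  have 4: "degree (2 * [:a:] * A * ([:0, 1:] * B)) \<le> 2 * degree A + 1"
  proof -
    have "degree ([:2 * a:] * A) \<le> degree A" by (simp add: degree_smult_le)
    then have "degree ([:2 * a:] * A) + degree ([:0, 1:] * B) \<le> 2 * degree A + 1"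
      using degree_tB_le by linarith
    then show ?thesis
      unfolding c by (rule order.trans[OF degree_mult_le])
  qed
  have "(2 :: 'a poly) = [:2:]" by (simp add: numeral_poly)
  then show ?thesis
    unfolding succ_V_def using order.trans[OF degree_mult_le add_mono[OF _ degree_add_le[OF 3 4]], of "[:2:]" 0]
    by simp
qed

end

text \<open>Modulo such a \<open>P\<close>, U and W give A = t B and t A = b B, hence t^2 = b since
  \<open>P\<close> does not divide \<open>B\<close>, and V becomes 4 B^2 f(t). But t^2 - b and f(t)
  have no common factor when b and a^2 - 4 b are nonzero.\<close>

lemma no_common_prime_succ:
  fixes A B :: "'a::field poly"
  assumes two: "(2::'a) \<noteq> 0" and b: "b \<noteq> 0" and disc: "a\<^sup>2 \<noteq> 4 * b" and cop: "coprime A B"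
    and P: "prime_elem P" "P dvd succ_U [:b:] [:0, 1:] A B" "P dvd succ_V [:a:] [:b:] [:0, 1:] A B"
      "P dvd succ_W [:0, 1:] A B"
  shows False
proof -
  define t :: "'a poly" where "t = [:0, 1:]"
  define a' b' where "a' = [:a:]" and "b' = [:b:]"
  have const: "\<not> P dvd [:c:]" if "c \<noteq> 0" for c
  proof
    assume "P dvd [:c:]"
    moreover have "is_unit [:c:]" using that by (simp add: is_unit_pCons_iff)
    ultimately show False
      using P(1) dvd_unit_imp_unit by (auto simp: prime_elem_def)
  qed
  have W: "P dvd A - t * B" and U: "P dvd A * t - b' * B"
    using P prime_elem_dvd_power unfolding succ_U_def succ_W_def t_def b'_def by blast+
  have nB: "\<not> P dvd B"
  proof
    assume B: "P dvd B"
    then have "P dvd (A - t * B) + t * B"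
      using W by (intro dvd_add) auto
    then have "P dvd A" by simp
    then show False
      using cop B P(1) coprime_common_divisor by (auto simp: prime_elem_def)
  qed
  have "P dvd (A * t - b' * B) - t * (A - t * B)"
    by (rule dvd_diff[OF U dvd_mult[OF W]])
  also have "\<dots> = B * (t\<^sup>2 - b')" by algebra
  finally have t2: "P dvd t\<^sup>2 - b'"
    using P(1) nB prime_elem_dvd_mult_iff by blast
  \<comment> \<open>\<open>X\<close> is the cofactor that replaces \<open>A\<close> by
    \<open>t * B\<close> in V.\<close>
  define X where "X = - 2 * (t * (A + t * B) + t * (t * B) + b' * B + 2 * a' * t * B)"
  have "P dvd succ_V a' b' t A B + (A - t * B) * X"
    using P(3) W unfolding a'_def b'_def t_def by (intro dvd_add) auto
  also have "\<dots> = 4 * B\<^sup>2 * (t * (t\<^sup>2 + a' * t + b'))"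
    unfolding X_def succ_V_def by algebra
  also have "\<dots> = [:4:] * B * B * (t * (t\<^sup>2 + a' * t + b'))"
    by (simp add: numeral_poly power2_eq_square)
  finally have "P dvd t * (t\<^sup>2 + a' * t + b')"
  proof -
    assume *: "P dvd [:4:] * B * B * (t * (t\<^sup>2 + a' * t + b'))"
    have "(4::'a) = 2 * 2" by simp
    then have "\<not> P dvd [:4:]" using const two by (metis mult_eq_0_iff)
    then show ?thesis
      using * nB P(1) prime_elem_dvd_mult_iff by blast
  qed
  then consider "P dvd t" | "P dvd t\<^sup>2 + a' * t + b'"
    using P(1) prime_elem_dvd_mult_iff by blast
  then show False
  proof cases
    case 1
    then have "P dvd t * t - (t\<^sup>2 - b')"
      by (intro dvd_diff[OF _ t2] dvd_mult)
    then show False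
      using const b by (simp add: power2_eq_square b'_def)
  next
    case 2
    then have "P dvd (t\<^sup>2 + a' * t + b') - (t\<^sup>2 - b')"
      by (rule dvd_diff[OF _ t2])
    \<comment> \<open>Modulo t^2 - b, the product of a t + 2 b and a t - 2 b is the nonzero constant
      b (a^2 - 4 b).\<close>
    then have "P dvd (a' * t - 2 * b') * ((t\<^sup>2 + a' * t + b') - (t\<^sup>2 - b')) - a'\<^sup>2 * (t\<^sup>2 - b')"
      by (rule dvd_diff[OF dvd_mult dvd_mult[OF t2]])
    also have "\<dots> = b' * (a'\<^sup>2 - 4 * b')" by algebra
    also have "\<dots> = [:b * (a\<^sup>2 - 4 * b):]"
      by (simp add: a'_def b'_def numeral_poly power2_eq_square)
    finally show False
      using const b disc by (metis eq_iff_diff_eq_0 mult_eq_0_iff)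
  qed
qed

text \<open>Vieta: if A / B is one root of the quadratic belonging to C / D, the other root E / F
  satisfies U = A E, W = B F and V = A F + E B. The degree formula comes from U, whose degree is
  known exactly.\<close>

lemma linked_step:
  fixes A B C D :: "'a::field poly"
  assumes two: "(2::'a) \<noteq> 0" and b: "b \<noteq> 0" and disc: "a\<^sup>2 \<noteq> 4 * b"
    and L: "linked a b A B C D"
  obtains E F where "linked a b C D E F" and "degree A + degree E = 2 * degree C + 2"
proof -
  define U V W where "U = succ_U [:b:] [:0, 1:] C D" and "V = succ_V [:a:] [:b:] [:0, 1:] C D"
    and "W = succ_W [:0, 1:] C D"
  have L': "coprime A B" "coprime C D" "dominates A B" "dominates C D"
    and rel: "W * A\<^sup>2 - V * A * B + U * B\<^sup>2 = 0"
    using L by (auto simp: linked_def biquad_def U_def V_def W_def)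
  have A0: "A \<noteq> 0" using L'(3) by (simp add: dominates_def)
  have "\<exists>E F. U = A * E \<and> W = B * F \<and> V = A * F + E * B"
  proof (cases "B = 0")
    \<comment> \<open>Point at infinity: \<open>A\<close> is a unit and the relation forces W =
      0.\<close>
    case True
    then have "is_unit A" using L'(1) by simp
    then obtain E F where "U = A * E" "V = A * F"
      by (meson dvdE unit_imp_dvd)
    moreover have "W = 0" using rel True A0 by simp
    ultimately show ?thesis using True by auto
  next
    case False
    have "W * A\<^sup>2 = B * (V * A - U * B)"
      using rel by algebra
    then have "B dvd A * (A * W)" by (metis dvd_triv_left mult.commute mult.assoc power2_eq_square)
    then have "B dvd W"
      using L'(1) field_poly_coprime_dvd_mult coprime_commute by blast
    then obtain F where F: "W = B * F" by (auto simp: dvd_def)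
    have "B * (A * (V - F * A)) = B * (B * U)"
      using rel F by algebra
    then have eq: "A * (V - F * A) = B * U" using False by simp
    then have "A dvd B * U" by (metis dvd_triv_left)
    then have "A dvd U"
      using L'(1) field_poly_coprime_dvd_mult by blast
    then obtain E where E: "U = A * E" by (auto simp: dvd_def)
    have "A * (V - F * A) = A * (B * E)" using eq E by algebra
    then have "V - F * A = B * E" using A0 by simp
    then have "V = A * F + E * B" by algebra
    then show ?thesis using E F by auto
  qed
  then obtain E F where UVW: "U = A * E" "W = B * F" "V = A * F + E * B" by blast
  have U: "degree U = 2 * degree C + 2" "U \<noteq> 0"
    using degree_succ_U[OF L'(4)] succ_U_nz[OF L'(4)] by (simp_all add: U_def)
  then have E0: "E \<noteq> 0" using UVW by auto
  then have deg: "degree A + degree E = 2 * degree C + 2"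
    using U UVW A0 by (simp add: degree_mult_eq)
  \<comment> \<open>If deg F were at least deg E, then A F would lead in V, with degree at least 2
    deg C + 2, exceeding the bound on deg V by one.\<close>
  have dom: "dominates E F"
  proof (rule ccontr)
    assume "\<not> dominates E F"
    then have F: "F \<noteq> 0" "degree E \<le> degree F" using E0 by (auto simp: dominates_def)
    have AF: "degree (A * F) = degree A + degree F" using A0 F by (simp add: degree_mult_eq)
    have "degree (E * B) < degree (A * F) \<or> E * B = 0"
      using L'(3) AF F E0 by (auto simp: dominates_def degree_mult_eq)
    then have "degree V = degree (A * F)"
      unfolding UVW(3) by (auto simp: degree_add_eq_left)
    then show False
      using AF F deg degree_succ_V[OF L'(4), of a b] by (simp add: V_def)
  qed
  have cop: "coprime E F"
  proof (rule coprimeI, rule ccontr)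
    fix G assume G: "G dvd E" "G dvd F" "\<not> is_unit G"
    then obtain P where P: "prime_elem P" "P dvd G"
      using field_poly_prime_divisor_exists by blast
    have "P dvd E" "P dvd F" using G P dvd_trans by blast+
    then have "P dvd U" "P dvd V" "P dvd W" unfolding UVW by auto
    then show False
      using no_common_prime_succ[OF two b disc L'(2) P(1)] by (simp add: U_def V_def W_def)
  qed
  have "biquad [:a:] [:b:] [:0, 1:] E F C D = W * E\<^sup>2 - V * E * F + U * F\<^sup>2"
    by (simp add: biquad_def U_def V_def W_def)
  also have "\<dots> = 0" unfolding UVW by algebra
  finally have "linked a b C D E F"
    using L' cop dom biquad_sym by (metis linked_def)
  then show thesis using deg that by blast
qed

text \<open>The recurrence of \<open>linked_step\<close> has constant second difference 2, so the
  degrees follow the monic quadratic in n with the given values at 0 and 1. The induction carries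
  two neighbours because a step needs both.\<close>

lemma linked_chain:
  fixes A B C D :: "'a::field poly"
  assumes two: "(2::'a) \<noteq> 0" and b: "b \<noteq> 0" and disc: "a\<^sup>2 \<noteq> 4 * b"
    and L: "linked a b A B C D"
  shows "\<exists>E F G H. linked a b E F G H \<and>
    int (degree E) = int n * int n + int n * (int (degree C) - int (degree A) - 1) + int (degree A) \<and>
    int (degree G) = int (Suc n) * int (Suc n) + int (Suc n) * (int (degree C) - int (degree A) - 1) + int (degree A)"
proof (induction n)
  case 0
  show ?case using L by fastforce
next
  case (Suc n)
  then obtain E F G H where *: "linked a b E F G H"
    "int (degree E) = int n * int n + int n * (int (degree C) - int (degree A) - 1) + int (degree A)"
    "int (degree G) = int (Suc n) * int (Suc n) + int (Suc n) * (int (degree C) - int (degree A) - 1) + int (degree A)"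
    by blast
  obtain I J where IJ: "linked a b G H I J" "degree E + degree I = 2 * degree G + 2"
    using linked_step[OF two b disc *(1)] .
  have "int (degree I) = 2 * int (degree G) + 2 - int (degree E)"
    using IJ(2) by linarith
  then have "int (degree I) = int (Suc (Suc n)) * int (Suc (Suc n)) + int (Suc (Suc n)) * (int (degree C) - int (degree A) - 1) + int (degree A)"
    unfolding * by (simp add: algebra_simps)
  then show ?case using IJ(1) *(3) by blast
qed

text \<open>Reduction to lowest terms that remembers a known divisor \<open>g\<close> of the
  cancelled factor, so that deg g limits deg A from above. \<open>A\<close> is taken of least
  degree.\<close>

lemma cancel_common_factor:
  fixes N W g :: "'a::field poly"
  assumes "N \<noteq> 0" and "g dvd N" and "g dvd W"
  obtains A B G where "N = A * G" and "W = B * G" and "g dvd G" and "coprime A B"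
proof -
  define P where "P A \<longleftrightarrow> (\<exists>B G. N = A * G \<and> W = B * G \<and> g dvd G)" for A
  obtain A0 B0 where "N = g * A0" "W = g * B0"
    using assms by (auto simp: dvd_def)
  then have "P A0"
    unfolding P_def by (metis dvd_refl mult.commute)
  then obtain A where "P A" and min: "\<And>A'. P A' \<Longrightarrow> degree A \<le> degree A'"
    using ex_has_least_nat[of P A0 degree] by auto
  then obtain B G where ABG: "N = A * G" "W = B * G" "g dvd G"
    unfolding P_def by blast
  have "coprime A B"
  proof (rule coprimeI)
    fix c assume "c dvd A" "c dvd B"
    then obtain A' B' where c: "A = c * A'" "B = c * B'"
      by (auto simp: dvd_def)
    have "N = A' * (c * G)" "W = B' * (c * G)" "g dvd c * G"
      using ABG c by (auto simp: mult_ac)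
    then have "degree A \<le> degree A'"
      using min unfolding P_def by blast
    moreover have "c \<noteq> 0" "A' \<noteq> 0"
      using ABG(1) c assms(1) by auto
    ultimately show "is_unit c"
      using c(1) by (simp add: degree_mult_eq is_unit_iff_degree)
  qed
  then show thesis
    using that ABG by blast
qed

section \<open>The quadratic character of a finite field of odd order\<close>

lemma power_card_eq_same:
  fixes x :: "'a::{finite, field}"
  shows "x ^ card (UNIV :: 'a set) = x"
proof (cases "x = 0")
  case False
  have "(\<Prod>y\<in>UNIV-{0}. x * y) = (\<Prod>y\<in>UNIV-{0}. y)"
    by (rule prod.reindex_bij_witness[of _ "\<lambda>y. y / x" "\<lambda>y. x * y"]) (use False in auto)
  then have "x ^ (card (UNIV :: 'a set) - 1) * \<Prod>(UNIV-{0}) = 1 * \<Prod>(UNIV-{0::'a})"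
    by (simp add: prod.distrib)
  then have "x ^ (card (UNIV :: 'a set) - 1) = 1"
    by (subst (asm) mult_right_cancel) auto
  then show ?thesis
    using power_Suc[of x "card (UNIV :: 'a set) - 1"] finite_UNIV_card_ge_0[where ?'a = 'a] by simp
qed (use finite_UNIV_card_ge_0[where ?'a = 'a] in auto)

text \<open>Both sides are monic of degree q and agree at all q field elements. This turns the q-th
  power of f into f evaluated at t^q.\<close>

lemma linear_power_card:
  fixes e :: "'a::{finite, field}"
  shows "[:-e, 1:] ^ card (UNIV :: 'a set) = [:0, 1:] ^ card (UNIV :: 'a set) - [:e:]"
proof (rule poly_eqI_degree_lead_coeff[where A = UNIV])
  let ?q = "card (UNIV :: 'a set)"
  have q: "0 < ?q"
    by (simp add: finite_UNIV_card_ge_0)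
  have d: "degree ([:c, 1::'a:] ^ ?q) = ?q" for c
    by (simp add: degree_power_eq)
  have m: "coeff ([:c, 1::'a:] ^ ?q) ?q = 1" for c
    using lead_coeff_power[of "[:c, 1::'a:]" ?q] by (simp add: d)
  show "coeff ([:-e, 1:] ^ ?q) ?q = coeff ([:0, 1:] ^ ?q - [:e:]) ?q"
    using q by (simp add: m coeff_pCons split: nat.split)
  show "degree ([:-e, 1:] ^ ?q) \<le> ?q" "degree ([:0, 1:] ^ ?q - [:e:]) \<le> ?q"
    using d by (auto intro!: degree_diff_le)
qed (auto simp: power_card_eq_same)

text \<open>Euler's criterion taken as the definition; integer values allow character sums to be
  compared by size.\<close>

definition qchar :: "'a::{finite, field} \<Rightarrow> int" where
  "qchar x = (if x = 0 then 0 else if x ^ ((card (UNIV :: 'a set) - 1) div 2) = 1 then 1 else -1)"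

locale odd_field =
  fixes q m :: nat and ty :: "'a::{finite, field} itself"
  assumes odd: "odd q" and q: "q = card (UNIV :: 'a set)" and m: "m = (card (UNIV :: 'a set) - 1) div 2"
begin

lemma q_eq: "q = 2 * m + 1"
  using odd unfolding m q[symmetric] by (auto elim: oddE)

lemma m_pos: "0 < m"
proof (rule ccontr)
  assume "\<not> 0 < m"
  then have "card (UNIV :: 'a set) = 1"
    using q_eq q by simp
  then show False
    by (metis card_1_singletonE UNIV_I singletonD zero_neq_one)
qed

lemma power_half_cases:
  fixes x :: 'a
  assumes "x \<noteq> 0"
  shows "x ^ m = 1 \<or> x ^ m = -1"
proof -
  have "x * (x ^ m * x ^ m) = x * 1"
    using power_card_eq_same[of x] unfolding q[symmetric] q_eq
    by (simp add: power_add[symmetric] mult_2)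
  then show ?thesis
    using assms by (simp add: square_eq_1_iff)
qed

text \<open>t^m - 1 has at most m roots, but there are 2 m nonzero elements.\<close>

lemma nonresidue_exists: "\<exists>x::'a. x \<noteq> 0 \<and> x ^ m \<noteq> 1"
proof (rule ccontr)
  assume *: "\<not> ?thesis"
  define p where "p = monom 1 m - (1 :: 'a poly)"
  have "coeff p m = 1"
    using m_pos by (simp add: p_def)
  then have "p \<noteq> 0" by auto
  have "UNIV - {0} \<subseteq> {x. poly p x = 0}"
    using * by (auto simp: p_def poly_monom)
  then have "card (UNIV - {0::'a}) \<le> card {x. poly p x = 0}"
    by (intro card_mono) auto
  also have "\<dots> \<le> degree p"
    using \<open>p \<noteq> 0\<close> by (rule card_poly_roots_bound)
  also have "\<dots> \<le> m"
    unfolding p_def by (intro degree_diff_le) (auto simp: degree_monom_le)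
  finally show False
    using q_eq q m_pos by simp
qed

lemma minus_one_neq_one: "(-1::'a) \<noteq> 1"
  using nonresidue_exists power_half_cases by metis

lemma two_neq_zero: "(2::'a) \<noteq> 0"
  using minus_one_neq_one by (metis add_eq_0_iff one_add_one)

lemma qchar_eq: "qchar (x::'a) = (if x = 0 then 0 else if x ^ m = 1 then 1 else -1)"
  by (simp only: qchar_def m)

lemma of_int_qchar: "of_int (qchar x) = (x::'a) ^ m"
  using power_half_cases[of x] m_pos by (auto simp: qchar_eq)

lemma qchar_eqI:
  assumes "x ^ m = of_int c" and "c \<in> {-1, 0, 1}"
  shows "qchar (x::'a) = c"
proof -
  have "x \<noteq> 0 \<Longrightarrow> x ^ m \<noteq> 0" by simp
  then show ?thesis
    using assms minus_one_neq_one minus_one_neq_one[symmetric] m_pos power_half_cases[of x]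
    by (auto simp: qchar_eq power_0_left)
qed

lemma qchar_mult: "qchar (x * y :: 'a) = qchar x * qchar y"
  by (rule qchar_eqI) (simp add: power_mult_distrib of_int_qchar, auto simp: qchar_def)

lemma qchar_0 [simp]: "qchar (0::'a) = 0" and qchar_1 [simp]: "qchar (1::'a) = 1"
  by (auto simp: qchar_def)

lemma qchar_square: "x \<noteq> 0 \<Longrightarrow> qchar x * qchar x = 1" for x :: 'a
  by (auto simp: qchar_def)

lemma qchar_le_1: "qchar x \<le> 1" and qchar_ge_m1: "-1 \<le> qchar x" for x :: 'a
  by (auto simp: qchar_def)

lemma qchar_eq_1_iff: "qchar x = 1 \<longleftrightarrow> x ^ m = 1" for x :: 'a
  using m_pos by (auto simp: qchar_eq power_0_left)

section \<open>The Hasse bound for cubic character sums\<close>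

text \<open>
  The first step of the chain is \<open>x(P + Q) = N / W\<close> in the proof below; every \<open>r\<close> with \<open>\<chi> (f r) = 1\<close> cancels
  a factor \<open>(t - r)\<^sup>2\<close> and every root of \<open>f\<close> a factor \<open>t - r\<close>, which brings in the character sum.
\<close>

lemma hasse_bound_root_zero:
  fixes u v :: 'a
  assumes uv: "u \<noteq> 0" "v \<noteq> 0" "u \<noteq> v"
  defines "S \<equiv> (\<Sum>x\<in>UNIV. qchar (x * (x - u) * (x - v)))"
  assumes "0 < S"
  shows "S\<^sup>2 \<le> 4 * int q"
proof -
  define R where "R = {x. qchar (x * (x - u) * (x - v)) = 1}"
  define n1 where "n1 = card R"
  have cardZ: "card {0, u, v} = 3"
    using uv by auto
  have Sval: "S = 2 * int n1 + 3 - int q"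
  proof -
    \<comment> \<open>The summand is 1 on \<open>R\<close>, 0 at the three roots and -1
      elsewhere.\<close>
    have "S = (\<Sum>x\<in>UNIV. 2 * (if x \<in> R then 1 else 0) + (if x \<in> {0, u, v} then 1 else 0) - 1)"
      unfolding S_def by (rule sum.cong) (auto simp: R_def qchar_def)
    also have "\<dots> = 2 * int n1 + int (card {0, u, v}) - int q"
      unfolding sum_subtractf sum.distrib sum_distrib_left[symmetric]
      by (simp add: sum.If_cases n1_def q del: insert_iff)
    finally show ?thesis using cardZ by simp
  qed
  define a b where "a = -(u + v)" and "b = u * v"
  \<comment> \<open>The chain starts at (\<open>T\<close>, \<open>h\<close>). \<open>Fq\<close> is f
    evaluated at \<open>T\<close>, so \<open>fh\<close> below says that this point lies on f(t) y^2
    = f(x).\<close>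
  define t T where "t = [:0, 1::'a:]" and "T = t ^ q"
  define f where "f = t * [:-u, 1:] * [:-v, 1:]"
  define h where "h = f ^ m"
  define Fq where "Fq = T * (T - [:u:]) * (T - [:v:])"
  have b0: "b \<noteq> 0" using uv by (simp add: b_def)
  have disc: "a\<^sup>2 \<noteq> 4 * b"
  proof
    assume "a\<^sup>2 = 4 * b"
    then have "(u - v)\<^sup>2 = 0" unfolding a_def b_def by algebra
    then show False using uv by simp
  qed
  have f_eq: "f = t * (t\<^sup>2 + [:a:] * t + [:b:])"
    by (simp add: f_def t_def a_def b_def power2_eq_square algebra_simps)
  have Fq_eq: "Fq = T * (T\<^sup>2 + [:a:] * T + [:b:])"
  proof -
    have "[:a:] = - ([:u:] + [:v:])" "[:b:] = [:u:] * [:v:]" by (auto simp: a_def b_def)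
    then show ?thesis
      unfolding Fq_def by algebra
  qed
  have fh: "f * h\<^sup>2 = Fq"
  proof -
    have "f * h\<^sup>2 = f ^ q"
      unfolding h_def q_eq by (simp add: power_mult[symmetric] mult.commute)
    also have "\<dots> = Fq"
      unfolding f_def power_mult_distrib Fq_def T_def t_def q linear_power_card ..
    finally show ?thesis .
  qed
  define W V U where "W = succ_W t T 1" and "V = succ_V [:a:] [:b:] t T 1" and "U = succ_U [:b:] t T 1"
  define V' where "V' = (T * t + [:b:]) * (T + t) + 2 * [:a:] * T * t"
  have V: "V = 2 * V'" by (simp add: V_def V'_def succ_V_def)
  \<comment> \<open>The chord through (\<open>T\<close>, \<open>h\<close>) and (t, 1) has slope (h -
    1) / (T - t); \<open>N\<close> is the x-coordinate of the sum times W = (T - t)^2.\<close>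
  define N where "N = f * (h - 1)\<^sup>2 - ([:a:] + T + t) * W"
  have N: "N = V' - 2 * f * h"
  proof -
    have "N = Fq + f - 2 * f * h - ([:a:] + T + t) * W"
      unfolding N_def fh[symmetric] by algebra
    also have "\<dots> = V' - 2 * f * h"
      unfolding f_eq Fq_eq W_def V'_def succ_W_def by algebra
    finally show ?thesis .
  qed
  \<comment> \<open>Since N - V' = - 2 f h and f h^2 = f(T), this is the discriminant identity V'^2
    - U W = 4 f f(T).\<close>
  have quad: "N\<^sup>2 - V * N + U * W = 0"
  proof -
    have "N\<^sup>2 - V * N + U * W = 4 * f * (f * h\<^sup>2) - V'\<^sup>2 + U * W"
      unfolding N V by algebra
    also have "\<dots> = 0"
      unfolding fh unfolding Fq_eq f_eq V'_def U_def W_def succ_U_def succ_W_def by algebra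
    finally show ?thesis .
  qed
  have q3: "3 \<le> q" using m_pos q_eq by simp
  have t0: "t \<noteq> 0" "degree t = 1" by (auto simp: t_def)
  have T0: "T \<noteq> 0" "degree T = q" using t0 by (auto simp: T_def degree_power_eq)
  have f0: "f \<noteq> 0" "degree f = 3"
  proof -
    have "f = [:0, u * v, - (u + v), 1:]"
      by (simp add: f_def t_def algebra_simps)
    then show "f \<noteq> 0" "degree f = 3" by simp_all
  qed
  have degN: "degree N = 2 * q + 1"
  proof -
    have 1: "degree (T * t + [:b:]) = q + 1"
      using t0 T0 by (subst degree_add_eq_left) (auto simp: degree_mult_eq)
    have 2: "degree (T + t) = q"
      using t0 T0 q3 by (subst degree_add_eq_left) auto
    have "T * t + [:b:] \<noteq> 0" "T + t \<noteq> 0"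
      using 1 2 q3 by auto
    then have 3: "degree ((T * t + [:b:]) * (T + t)) = 2 * q + 1"
      using 1 2 by (subst degree_mult_eq) auto
    have "2 * [:a:] * T * t = [:2 * a:] * (T * t)" by (simp add: numeral_poly mult.commute)
    also have "degree \<dots> \<le> q + 1"
      using t0 T0 degree_smult_le[of "2 * a" "T * t"] by (simp add: degree_mult_eq)
    finally have V': "degree V' = 2 * q + 1"
      unfolding V'_def using 3 q3 by (subst degree_add_eq_left) auto
    \<comment> \<open>3 (m + 1) is below 2 q + 1 = 4 m + 3 because m > 0, so the term T^2 t of
      \<open>V'\<close> leads in \<open>N\<close>.\<close>
    have "degree (f * h) = 3 * (m + 1)"
      using f0 by (simp add: h_def degree_mult_eq degree_power_eq)
    moreover have "2 * f * h = [:2:] * (f * h)" by (simp add: numeral_poly)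
    ultimately have "degree (2 * f * h) < 2 * q + 1"
      using degree_smult_le[of 2 "f * h"] q_eq m_pos by simp
    then show ?thesis
      unfolding N diff_conv_add_uminus using V' by (subst degree_add_eq_left) auto
  qed
  then have N0: "N \<noteq> 0" by auto
  have degW: "degree W = 2 * q" "W \<noteq> 0"
  proof -
    have "degree (T - t) = q"
      unfolding diff_conv_add_uminus using t0 T0 q3 by (subst degree_add_eq_left) auto
    moreover from this have "T - t \<noteq> 0" using q3 by auto
    ultimately show "degree W = 2 * q" "W \<noteq> 0"
      by (auto simp: W_def succ_W_def degree_power_eq)
  qed
  define G1 where "G1 = (\<Prod>r\<in>R. [:-r, 1:])"
  define g where "g = f * G1\<^sup>2"
  have poly_f: "poly f r = r * (r - u) * (r - v)" for r
    by (simp add: f_def t_def algebra_simps)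
  have G1h: "G1 dvd h - 1"
    unfolding G1_def
    by (rule prod_linear_factors_dvd) (auto simp: R_def h_def poly_f qchar_eq_1_iff)
  \<comment> \<open>\<open>T - t\<close> vanishes at every field element, and \<open>R\<close>
    avoids the roots of f, so no linear factor repeats.\<close>
  have fG1: "f * G1 dvd T - t"
  proof -
    have "f * G1 = (\<Prod>r\<in>{0, u, v} \<union> R. [:-r, 1:])"
      unfolding G1_def by (subst prod.union_disjoint) (use uv in \<open>auto simp: R_def f_def t_def mult_ac\<close>)
    also have "\<dots> dvd T - t"
      by (rule prod_linear_factors_dvd) (auto simp: T_def t_def q power_card_eq_same)
    finally show ?thesis .
  qed
  have "g dvd W"
  proof -
    have "f * G1 * G1 dvd (T - t) * (T - t)"
      using fG1 dvd_mult_right[OF fG1] by (intro mult_dvd_mono)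
    then show ?thesis by (simp add: g_def W_def succ_W_def power2_eq_square mult.assoc)
  qed
  moreover have "g dvd N"
    unfolding N_def
  proof (rule dvd_diff)
    show "g dvd f * (h - 1)\<^sup>2"
      unfolding g_def by (rule mult_dvd_mono[OF dvd_refl dvd_power_same[OF G1h]])
  qed (use \<open>g dvd W\<close> in simp)
  ultimately obtain A B G where ABG: "N = A * G" "W = B * G" "g dvd G" "coprime A B"
    using cancel_common_factor[OF N0] by metis
  have nz: "A \<noteq> 0" "B \<noteq> 0" "G \<noteq> 0" using ABG N0 degW by auto
  have "degree G1 = n1"
    unfolding G1_def n1_def by (subst degree_prod_eq_sum_degree) auto
  moreover have "G1 \<noteq> 0" unfolding G1_def by auto
  ultimately have "degree g = 3 + 2 * n1"
    unfolding g_def using f0 by (simp add: degree_mult_eq degree_power_eq)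
  then have degG: "3 + 2 * n1 \<le> degree G"
    using dvd_imp_degree_le[OF ABG(3)] nz by simp
  have degA: "degree A + degree G = 2 * q + 1" and degB: "degree B + degree G = 2 * q"
    using ABG(1,2) degN degW nz by (simp_all add: degree_mult_eq)
  have "biquad [:a:] [:b:] t A B T 1 * G\<^sup>2 = W * (N\<^sup>2 - V * N + U * W)"
    unfolding biquad_def W_def[symmetric] V_def[symmetric] U_def[symmetric]
    using ABG(1,2) by algebra
  then have "biquad [:a:] [:b:] t A B T 1 = 0"
    using quad nz by simp
  then have "linked a b T 1 A B"
    using ABG(4) degA degB nz T0 q3
    by (subst (asm) biquad_sym) (auto simp: linked_def dominates_def t_def)
  then have chain: "0 \<le> int n * int n + int n * (int (degree A) - int q - 1) + int q" for n
    using linked_chain[OF two_neq_zero b0 disc, of T 1 A B n] T0 by fastforce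
  \<comment> \<open>S / 2 minimises n^2 - S n + q; it is an integer because q is odd. At this n the
    quadratic is q - n^2, and a degree cannot be negative.\<close>
  define n where "n = nat (S div 2)"
  have n: "S = 2 * int n"
    using \<open>0 < S\<close> Sval q_eq by (simp add: n_def)
  have "int (degree A) - int q - 1 \<le> - 2 * int n"
    using degA degG Sval n by linarith
  then have "int n * (int (degree A) - int q - 1) \<le> int n * (- 2 * int n)"
    by (intro mult_left_mono) auto
  then have "int n * int n \<le> int q"
    using chain[of n] by simp
  then show ?thesis
    by (simp add: n power2_eq_square)
qed

text \<open>Translation by \<open>u\<close> moves one root to 0. The form is one-sided, as only
  upper estimates of triple sums enter later.\<close>

lemma hasse_bound:
  fixes u v w :: 'a
  assumes "u \<noteq> v" "u \<noteq> w" "v \<noteq> w"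
  defines "S \<equiv> (\<Sum>x\<in>UNIV. qchar (x - u) * qchar (x - v) * qchar (x - w))"
  shows "S \<le> 0 \<or> S\<^sup>2 \<le> 4 * int q"
proof -
  have "S = (\<Sum>x\<in>UNIV. qchar (x * (x - (v - u)) * (x - (w - u))))"
    unfolding S_def
    by (rule sum.reindex_bij_witness[of _ "\<lambda>x. x + u" "\<lambda>x. x - u"]) (auto simp: qchar_mult)
  then show ?thesis
    using hasse_bound_root_zero[of "v - u" "w - u"] assms(1-3) by force
qed

section \<open>Character sums with one and two factors\<close>

text \<open>Scaling by a nonresidue permutes the field and flips the sign of the sum.\<close>

lemma sum_qchar: "(\<Sum>x\<in>UNIV. qchar (x - c :: 'a)) = 0"
proof -
  obtain z :: 'a where z: "z \<noteq> 0" "z ^ m \<noteq> 1"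
    using nonresidue_exists by blast
  then have "qchar z = -1"
    by (simp add: qchar_eq)
  moreover have "(\<Sum>x\<in>UNIV. qchar (x::'a)) = (\<Sum>x\<in>UNIV. qchar (z * x))"
    by (rule sum.reindex_bij_witness[of _ "\<lambda>x. z * x" "\<lambda>x. x / z"]) (use z in auto)
  ultimately have "(\<Sum>x\<in>UNIV. qchar (x::'a)) = (\<Sum>x\<in>UNIV. - qchar (x::'a))"
    by (simp add: qchar_mult)
  then have "(\<Sum>x\<in>UNIV. qchar (x::'a)) = 0"
    by (simp add: sum_negf)
  moreover have "(\<Sum>x\<in>UNIV. qchar (x - c :: 'a)) = (\<Sum>x\<in>UNIV. qchar (x::'a))"
    by (rule sum.reindex_bij_witness[of _ "\<lambda>x. x + c" "\<lambda>x. x - c"]) auto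
  ultimately show ?thesis by simp
qed

text \<open>Up to a nonzero square, (x - c) (x - d) is (x - d) / (x - c), which takes every value
  except 1 once as x runs over all elements except c. What remains is the full sum 0 minus the term
  at 1.\<close>

lemma sum_qchar_pair:
  fixes c d :: 'a
  assumes "c \<noteq> d"
  shows "(\<Sum>x\<in>UNIV. qchar (x - c) * qchar (x - d)) = -1"
proof -
  have "(\<Sum>x\<in>UNIV. qchar (x - c) * qchar (x - d)) = (\<Sum>x\<in>UNIV - {c}. qchar (x - c) * qchar (x - d))"
    by (subst sum.remove[of _ c]) auto
  also have "\<dots> = (\<Sum>y\<in>UNIV - {1}. qchar (y::'a))"
  proof (rule sum.reindex_bij_witness[of _ "\<lambda>y. (d - y * c) / (1 - y)" "\<lambda>x. (x - d) / (x - c)"])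
    fix x assume "x \<in> UNIV - {c}"
    then have x: "x - c \<noteq> 0" by simp
    have 1: "1 - (x - d) / (x - c) = (d - c) / (x - c)"
      using x by (simp add: field_simps)
    have 2: "d - (x - d) / (x - c) * c = x * (d - c) / (x - c)"
      using x by (simp add: field_simps)
    show "(d - (x - d) / (x - c) * c) / (1 - (x - d) / (x - c)) = x"
      unfolding 1 2 using x assms by simp
    show "(x - d) / (x - c) \<in> UNIV - {1}"
      using x assms by auto
    have "qchar (x - d) = qchar ((x - d) / (x - c)) * qchar (x - c)"
      unfolding qchar_mult[symmetric] using x by simp
    then show "qchar ((x - d) / (x - c)) = qchar (x - c) * qchar (x - d)"
      using qchar_square[OF x] by simp
  next
    fix y :: 'a assume "y \<in> UNIV - {1}"
    then have y: "1 - y \<noteq> 0" by simp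
    have 1: "(d - y * c) / (1 - y) - c = (d - c) / (1 - y)"
      using y by (simp add: field_simps)
    have 2: "(d - y * c) / (1 - y) - d = y * (d - c) / (1 - y)"
      using y by (simp add: field_simps)
    show "((d - y * c) / (1 - y) - d) / ((d - y * c) / (1 - y) - c) = y"
      unfolding 1 2 using y assms by simp
    show "(d - y * c) / (1 - y) \<in> UNIV - {c}"
      using 1 y assms by auto
  qed
  also have "\<dots> = -1"
    using sum_qchar[of 0] by (subst (asm) sum.remove[of _ 1]) auto
  finally show ?thesis .
qed

section \<open>Elements whose prescribed shifts are all nonresidues\<close>

lemma qchar_eq_m1_not_potent:
  fixes x :: 'a
  assumes "qchar x = -1"
  shows "\<not> potent (Suc m) x"
proof
  assume "potent (Suc m) x"
  then have "x * x ^ m = x * 1" by (simp add: potent_def)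
  then have "x = 0 \<or> x ^ m = 1" by simp
  then show False
    using assms by (auto simp: qchar_eq_1_iff[symmetric])
qed

lemma qchar_cases:
  fixes x :: 'a
  obtains "x = 0" "qchar x = 0" | "x \<noteq> 0" "qchar x = 1" | "x \<noteq> 0" "qchar x = -1"
  by (metis qchar_def)

text \<open>Serves the fields whose 4-potents are only 0 and 1. Without such an x, only x = 0
  contributes to the sum of \<open>P\<close>, at most 2 (at x = 1 the residue 1 kills a factor), but
  the sum is q - 1.\<close>

lemma two_nonresidues:
  assumes "3 < q"
  obtains x :: 'a where "qchar x = -1" "qchar (x - 1) = -1"
proof (rule ccontr)
  assume *: "\<not> thesis"
  define P where "P x = (1 - qchar (x - 0)) * (1 - qchar (x - 1))" for x :: 'a
  have "(\<Sum>x\<in>UNIV. P x) = (\<Sum>x\<in>UNIV. 1 - qchar (x - 0) - qchar (x - 1) + qchar (x - 0) * qchar (x - 1 :: 'a))"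
    by (rule sum.cong) (auto simp: P_def algebra_simps)
  also have "\<dots> = int q - 1"
    unfolding sum_subtractf sum.distrib sum_qchar sum_qchar_pair[OF zero_neq_one] q by simp
  finally have sum: "(\<Sum>x\<in>UNIV. P x) = int q - 1" .
  have bound: "P x \<le> (if x = 0 then 2 else 0)" for x
  proof (cases "x = 0 \<or> x = 1")
    case True
    then show ?thesis using qchar_ge_m1[of "-1"] by (auto simp: P_def)
  next
    case False
    then have "P x = 0"
      using * that qchar_cases[of x] qchar_cases[of "x - 1"] unfolding P_def
      by (metis diff_zero eq_iff_diff_eq_0 mult_eq_0_iff)
    then show ?thesis using False by simp
  qed
  have "(\<Sum>x\<in>UNIV. P x) \<le> (\<Sum>x\<in>UNIV. if x = (0::'a) then 2 else 0)"
    by (intro sum_mono bound)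
  also have "\<dots> = 2" by simp
  finally show False using sum assms by simp
qed

text \<open>-(x^(-3) - 1) is x (x^3 - 1) divided by the square x^4, so x -> 1 / x absorbs the factor
  x. The final -1 removes the term at x = 0, which is the square of
  \<open>qchar (-1)\<close>.\<close>

lemma sum_qchar_cube_roots:
  fixes w :: 'a
  assumes w: "w\<^sup>2 + w + 1 = 0"
  shows "(\<Sum>x\<in>UNIV. qchar x * qchar (x - 1) * qchar (x - w) * qchar (x - w\<^sup>2)) =
    qchar (-1 :: 'a) * (\<Sum>x\<in>UNIV. qchar (x - 1) * qchar (x - w) * qchar (x - w\<^sup>2)) - 1"
proof -
  have cube: "(x - 1) * (x - w) * (x - w\<^sup>2) = x ^ 3 - 1" for x
    using w by algebra
  have T: "qchar (x - 1) * qchar (x - w) * qchar (x - w\<^sup>2) = qchar (x ^ 3 - 1)" for x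
    unfolding qchar_mult[symmetric] cube ..
  have "(\<Sum>x\<in>UNIV. qchar x * qchar (x - 1) * qchar (x - w) * qchar (x - w\<^sup>2)) = (\<Sum>x\<in>UNIV. qchar (x::'a) * qchar (x ^ 3 - 1))"
    by (rule sum.cong[OF refl]) (simp only: T[symmetric] mult.assoc)
  also have "\<dots> = (\<Sum>x\<in>UNIV - {0}. qchar (x::'a) * qchar (x ^ 3 - 1))"
    by (subst sum.remove[of _ 0]) auto
  also have "\<dots> = (\<Sum>x\<in>UNIV - {0}. qchar (-1::'a) * qchar (x ^ 3 - 1 :: 'a))"
  proof (rule sum.reindex_bij_witness[of _ inverse inverse])
    fix x :: 'a assume "x \<in> UNIV - {0}"
    then have x: "x \<noteq> 0" by simp
    have "- 1 * (inverse x ^ 3 - 1) = x * (x ^ 3 - 1) * (inverse x * inverse x) * (inverse x * inverse x)"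
      using x by (simp add: field_simps power3_eq_cube)
    then have "qchar (-1::'a) * qchar (inverse x ^ 3 - 1) =
        qchar x * qchar (x ^ 3 - 1) * (qchar (inverse x) * qchar (inverse x)) * (qchar (inverse x) * qchar (inverse x))"
      unfolding qchar_mult[symmetric] by (rule arg_cong[of _ _ qchar])
    then show "qchar (-1::'a) * qchar (inverse x ^ 3 - 1) = qchar x * qchar (x ^ 3 - 1)"
      using qchar_square[of "inverse x"] x by simp
  qed auto
  also have "\<dots> = qchar (-1 :: 'a) * (\<Sum>x\<in>UNIV. qchar (x ^ 3 - 1 :: 'a)) - 1"
    using qchar_square[of "-1"] by (subst (2) sum.remove[of _ 0]) (auto simp: sum_distrib_left distrib_left)
  finally show ?thesis by (simp add: T)
qed

text \<open>Without such an x, \<open>P\<close> vanishes away from 0 and is at most 8 there. This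
  bounds q - 15 by a combination of triple sums, contradicting the Hasse bound.\<close>

lemma four_nonresidues:
  fixes w :: 'a
  assumes "124 < q" and w: "w\<^sup>2 + w + 1 = 0" "w \<noteq> 1"
  obtains x where "qchar x = -1" "qchar (x - 1) = -1" "qchar (x - w) = -1" "qchar (x - w\<^sup>2) = -1"
proof (rule ccontr)
  assume *: "\<not> thesis"
  have w3: "w * w\<^sup>2 = 1" "w ^ 4 = w" using w(1) by algebra+
  have w0: "w \<noteq> 0" using w3 by auto
  have dist: "(0::'a) \<noteq> 1" "0 \<noteq> w" "0 \<noteq> w\<^sup>2" "1 \<noteq> w" "1 \<noteq> w\<^sup>2" "w \<noteq> w\<^sup>2"
    using w w0 w3 by (auto simp: power2_eq_square)
  have qw: "qchar (w\<^sup>2) = 1"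
    using qchar_square[OF w0] by (simp add: power2_eq_square qchar_mult)
  \<comment> \<open>\<open>w\<close> is the square of w^2, so the factor \<open>1 - c0 x\<close>
    vanishes at x = w.\<close>
  have qw1: "qchar w = 1"
  proof -
    have "w\<^sup>2 * w\<^sup>2 = w" by (simp add: w3 flip: power_add)
    then show ?thesis by (metis qchar_mult qw mult_1)
  qed
  define c0 c1 c2 c3 where "c0 x = qchar (x - 0)" and "c1 x = qchar (x - 1)"
    and "c2 x = qchar (x - w)" and "c3 x = qchar (x - w\<^sup>2)" for x
  note c_defs = c0_def c1_def c2_def c3_def
  define S1 S2 S3 T where "S1 = (\<Sum>x\<in>UNIV. c0 x * c1 x * c2 x)" and "S2 = (\<Sum>x\<in>UNIV. c0 x * c1 x * c3 x)"
    and "S3 = (\<Sum>x\<in>UNIV. c0 x * c2 x * c3 x)" and "T = (\<Sum>x\<in>UNIV. c1 x * c2 x * c3 x)"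
  define e where "e = qchar (-1::'a)"
  have Q: "(\<Sum>x\<in>UNIV. c0 x * c1 x * c2 x * c3 x) = e * T - 1"
    using sum_qchar_cube_roots[OF w(1)] by (simp add: c_defs T_def e_def)
  define P where "P x = (1 - c0 x) * (1 - c1 x) * (1 - c2 x) * (1 - c3 x)" for x
  have "(\<Sum>x\<in>UNIV. P x) = (\<Sum>x\<in>UNIV. 1 - c0 x - c1 x - c2 x - c3 x
      + c0 x * c1 x + c0 x * c2 x + c0 x * c3 x + c1 x * c2 x + c1 x * c3 x + c2 x * c3 x
      - c0 x * c1 x * c2 x - c0 x * c1 x * c3 x - c0 x * c2 x * c3 x - c1 x * c2 x * c3 x
      + c0 x * c1 x * c2 x * c3 x)"
    by (rule sum.cong) (auto simp: P_def algebra_simps)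
  \<comment> \<open>Single sums vanish; the six pair sums and the constant in \<open>Q\<close> give
    -7.\<close>
  also have "\<dots> = int q - 7 - S1 - S2 - S3 - T + e * T"
    unfolding sum_subtractf sum.distrib Q S1_def[symmetric] S2_def[symmetric] S3_def[symmetric] T_def[symmetric]
    unfolding c_defs sum_qchar sum_qchar_pair[OF dist(1)] sum_qchar_pair[OF dist(2)] sum_qchar_pair[OF dist(3)]
      sum_qchar_pair[OF dist(4)] sum_qchar_pair[OF dist(5)] sum_qchar_pair[OF dist(6)] q
    by simp
  finally have sum: "(\<Sum>x\<in>UNIV. P x) = int q - 7 - S1 - S2 - S3 - T + e * T" .
  have bound: "P x \<le> (if x = 0 then 8 else 0)" for x
  proof (cases "x = 0")
    case True
    have "0 \<le> 1 - qchar y" "1 - qchar y \<le> 2" for y :: 'a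
      using qchar_le_1[of y] qchar_ge_m1[of y] by auto
    then have "(1 - c1 x) * (1 - c2 x) * (1 - c3 x) \<le> 2 * 2 * 2"
      unfolding c_defs by (intro mult_mono mult_nonneg_nonneg) auto
    then show ?thesis using True by (simp add: P_def c0_def)
  next
    case False
    have "P x = 0"
    proof (cases "x = 1 \<or> x = w \<or> x = w\<^sup>2")
      case True
      then show ?thesis using qw qw1 by (auto simp: P_def c0_def)
    next
      case F: False
      then have "c0 x = 1 \<or> c1 x = 1 \<or> c2 x = 1 \<or> c3 x = 1"
        using False * that[of x] unfolding c_defs
        by (smt (verit, best) diff_zero eq_iff_diff_eq_0 qchar_cases)
      then show ?thesis by (auto simp: P_def)
    qed
    then show ?thesis using False by simp
  qed
  have "(\<Sum>x\<in>UNIV. P x) \<le> (\<Sum>x\<in>UNIV. if x = (0::'a) then 8 else 0)"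
    by (intro sum_mono bound)
  then have ub: "int q - 15 \<le> S1 + S2 + S3 + T - e * T"
    using sum by simp
  have bounds: "S1 \<le> 0 \<or> S1\<^sup>2 \<le> 4 * int q" "S2 \<le> 0 \<or> S2\<^sup>2 \<le> 4 * int q"
    "S3 \<le> 0 \<or> S3\<^sup>2 \<le> 4 * int q" "T \<le> 0 \<or> T\<^sup>2 \<le> 4 * int q"
    unfolding S1_def S2_def S3_def T_def c_defs 
    by (rule hasse_bound[OF dist(1,2,4)] hasse_bound[OF dist(1,3,5)] hasse_bound[OF dist(2,3,6)] hasse_bound[OF dist(4,5,6)])+
  have "e = 1 \<or> e = -1"
    using qchar_cases[of "-1"] unfolding e_def by fastforce
  then show False
  proof
    assume e: "e = 1"
    \<comment> \<open>Here \<open>T\<close> cancels and three sums remain, so a third of q - 15 is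
      the threshold for each.\<close>
    have "3 * S < int q - 15" if "S \<le> 0 \<or> S\<^sup>2 \<le> 4 * int q" for S
    proof (rule ccontr)
      assume S: "\<not> 3 * S < int q - 15"
      then have "0 < S" using assms(1) by linarith
      have "(int q - 15) * (int q - 15) \<le> (3 * S) * (3 * S)"
        using S assms(1) by (intro mult_mono) auto
      also have "\<dots> \<le> 36 * int q"
        using that \<open>0 < S\<close> by (simp add: power2_eq_square)
      finally have "int q * (int q - 66) + 225 \<le> 0"
        by (simp add: algebra_simps)
      moreover have "0 \<le> int q * (int q - 66)" using assms(1) by (intro mult_nonneg_nonneg) auto
      ultimately show False by linarith
    qed
    from this[OF bounds(1)] this[OF bounds(2)] this[OF bounds(3)] show False
      using ub e by simp
  next
    assume e: "e = -1"
    \<comment> \<open>Now \<open>T\<close> counts twice, giving five summands. As -1 is a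
      nonresidue, q is 3 modulo 4, which leaves 127 and q at least 131.\<close>
    have "odd m"
    proof (rule ccontr)
      assume "\<not> odd m"
      then have "qchar (-1::'a) = 1" by (subst qchar_eq_1_iff) simp
      then show False using e e_def by simp
    qed
    then have "m = 63 \<or> 65 \<le> m"
      using q_eq assms(1) by presburger
    then have q127: "q = 127 \<or> 131 \<le> q"
      using q_eq by linarith
    have "5 * S < int q - 15" if "S \<le> 0 \<or> S\<^sup>2 \<le> 4 * int q" for S
    proof (rule ccontr)
      assume S: "\<not> 5 * S < int q - 15"
      then have "0 < S" using assms(1) by linarith
      then have S2: "S * S \<le> 4 * int q" using that by (simp add: power2_eq_square)
      from q127 show False
      proof
        \<comment> \<open>The quadratic estimate fails here, but integrality helps: 5 S >= 112 gives
          S >= 23, and 529 > 508.\<close>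
        assume "q = 127"
        then have "23 * 23 \<le> S * S" using S by (intro mult_mono) auto
        then show False using S2 \<open>q = 127\<close> by simp
      next
        assume q: "131 \<le> q"
        have "(int q - 15) * (int q - 15) \<le> (5 * S) * (5 * S)"
          using S q by (intro mult_mono) auto
        also have "\<dots> \<le> 100 * int q"
          using S2 by simp
        finally have "int q * (int q - 130) + 225 \<le> 0"
          by (simp add: algebra_simps)
        moreover have "0 \<le> int q * (int q - 130)" using q by (intro mult_nonneg_nonneg) auto
        ultimately show False by linarith
      qed
    qed
    from this[OF bounds(1)] this[OF bounds(2)] this[OF bounds(3)] this[OF bounds(4)] show False
      using ub e by simp
  qed
qed

end

section \<open>From nonresidues to sums of potents\<close>

theorem theorem2p2:
  fixes q n :: nat
  assumes "q = card (UNIV :: 'a::{finite, field} set)"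
    and "odd q" and "q > 124"
    and "n = (q + 1) div 2"
  shows "\<exists>\<gamma>::'a. \<not> (\<exists>\<alpha> \<beta>. potent n \<alpha> \<and> potent 4 \<beta> \<and> \<gamma> = \<alpha> + \<beta>)"
proof -
  define m where "m = (card (UNIV :: 'a set) - 1) div 2"
  interpret odd_field q m "TYPE('a)"
    using assms(1,2) m_def by unfold_locales
  have n: "n = Suc m"
    using q_eq assms(4) by simp
  have potent4: "\<beta> = 0 \<or> \<beta> = 1 \<or> \<beta>\<^sup>2 + \<beta> + 1 = 0" if "potent 4 \<beta>" for \<beta> :: 'a
  proof -
    have "\<beta> * ((\<beta> - 1) * (\<beta>\<^sup>2 + \<beta> + 1)) = \<beta> ^ 4 - \<beta>"
      by (simp add: power2_eq_square power4_eq_xxxx algebra_simps)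
    then have "\<beta> * ((\<beta> - 1) * (\<beta>\<^sup>2 + \<beta> + 1)) = 0"
      using that by (simp add: potent_def)
    then show ?thesis by simp
  qed
  show ?thesis
  proof (cases "\<exists>w::'a. w\<^sup>2 + w + 1 = 0 \<and> w \<noteq> 1")
    \<comment> \<open>This includes characteristic 3, where the only root of w^2 + w + 1 is 1. The
      4-potents are 0 and 1.\<close>
    case False
    obtain x :: 'a where x: "qchar x = -1" "qchar (x - 1) = -1"
      using two_nonresidues assms(3) by auto
    have "\<not> potent n (x - \<beta>)" if "potent 4 \<beta>" for \<beta>
      using potent4[OF that] False x qchar_eq_m1_not_potent n by auto
    then show ?thesis
      by (metis add_diff_cancel_right')
  next
    case True
    then obtain w :: 'a where w: "w\<^sup>2 + w + 1 = 0" "w \<noteq> 1" by blast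
    obtain x where x: "qchar x = -1" "qchar (x - 1) = -1" "qchar (x - w) = -1" "qchar (x - w\<^sup>2) = -1"
      using four_nonresidues[OF assms(3) w] by blast
    have "\<not> potent n (x - \<beta>)" if "potent 4 \<beta>" for \<beta>
    proof -
      have "\<beta> = w \<or> \<beta> = w\<^sup>2" if "\<beta>\<^sup>2 + \<beta> + 1 = 0"
      proof -
        have "(\<beta> - w) * (\<beta> - w\<^sup>2) = 0" using that w(1) by algebra
        then show ?thesis by simp
      qed
      then show ?thesis
        using potent4[OF that] x qchar_eq_m1_not_potent n by auto
    qed
    then show ?thesis
      by (metis add_diff_cancel_right')
  qed
qed

end
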